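(* Let $G=(V,A)$ be a time-dependent network instance with $n$ vertices and period $T=n^{a}$ for a constant $a\in(0,1)$, satisfying the Bounded Travel-Time Slopes assumption with constants $\Lambda_{\min}\in[0,1)$, $\Lambda_{\max}>0$, and satisfying $\underline{\Gamma}[o,d]\le f(n)\cdot(\underline{D}[o,d])^{\lambda}$ for all $o,d\in V$ (for some $\lambda\ge1$ and $f:\mathbb N\to[1,\infty)$). Let $\varepsilon>0$ be a constant, let $L\subseteq V$, fix $\ell\in L$, an integer $F>f(n)$, and $\tau\in(0,T)$ such that $|V[\ell](\tau)|=n-F$, where \[ \tau[\ell,v]=\frac{\underline{D}[\ell,v]}{(1+1/\varepsilon)\Lambda_{\max}},\qquad V[\ell](\tau)=\{v\in V:\tau[\ell,v]>\tau\}. \] Let $\tau^*=\min_{v\in V[\ell](\tau)}\tau[\ell,v]$. For $k\in\{1,\dots,\lceil T/\tau^*\rceil\}$ let $I_k=[t_{s_k},t_{f_k})$ with $t_{s_k}=(k-1)\tau^*$, $t_{f_k}=\min\{k\tau^*,T\}$, and for $v\in V[\ell](\tau)$ and $t\in I_k$ let \[ \overline{\delta}_k[\ell,v](t)=\min\{D[\ell,v](t_{f_k})+\Lambda_{\min}t_{f_k}-\Lambda_{\min}t,\;D[\ell,v](t_{s_k})-\Lambda_{\max}t_{s_k}+\Lambda_{\max}t\}. \] Let $\overline{\Delta}[\ell,v]:[0,T)\to\mathbb R$ be the concatenation of the functions $\overline{\delta}_k[\ell,v]$ over all $k$ (extended periodically). Then for every $v\in V[\ell](\tau)$, $\overline{\Delta}[\ell,v]$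 is a $(1+\varepsilon)$-upper-approximation of $D[\ell,v]$ on $[0,T)$ (i.e. $D[\ell,v](t)\le\overline{\Delta}[\ell,v](t)\le(1+\varepsilon)D[\ell,v](t)$ for all $t$), and it is a piecewise linear function with at most $2\lceil T/\tau^*\rceil$ breakpoints. Constructing all these functions (simultaneously for all $v\in V[\ell](\tau)$) requires solving the one-to-all problem $TDSP(\ell,\star,t)$ for $\lceil T/\tau^*\rceil$ departure times $t$, and \[ \left\lceil\frac{T}{\tau^*}\right\rceil\le 1+\frac{T(1+1/\varepsilon)\Lambda_{\max}}{\min_{v\in V[\ell](\tau)}\underline{D}[\ell,v]}\in O(n^{a}), \] where the constant in the $O(\cdot)$ depends only on $\varepsilon$ and $\Lambda_{\max}$.
   Context: A time-dependent network instance: directed graph $G=(V,A)$, $n=|V|$, each arc $a$ with a continuous, piecewise linear, periodic (period $T$) arc-travel-time function $D[a]:[0,\infty)\to(0,\infty)$. With $Arr[a](t)=t+D[a](t)$, a path $p=\langle a_1,\dots,a_k\rangle$ has $Arr[p](t)=Arr[a_k](\cdots Arr[a_1](t)\cdots)$, $D[p](t)=Arr[p](t)-t$, and $D[o,d](t)=\min_pD[p](t)$ over $o$–$d$ paths is the minimum-travel-time function. The free-flow metric assigns each arc the static length $\underline{D}[a]=\min_{t\in[0,T)}D[a](t)$; $\underline{D}[o,d]$ is the shortest-path distance from $o$ to $d$ under these lengths, and $\underline{\Gamma}[o,d]$ (free-flow Dijkstra-Rank) is the number of vertices settled by Dijkstra's algorithm from $o$ in the free-flow metric until $d$ is settled.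 $TDSP(\ell,\star,t)$ denotes the problem of computing $D[\ell,v](t)$ for all $v\in V$ for the single departure time $t$ from $\ell$. Bounded Travel-Time Slopes assumption: constants $\Lambda_{\min}\in[0,1)$, $\Lambda_{\max}\ge0$ with $\frac{D[o,d](t_1)-D[o,d](t_2)}{t_1-t_2}\in[-\Lambda_{\min},\Lambda_{\max}]$ for all $o,d$ and $0\le t_1<t_2$.
   Formalization: The upper bound Δ ≤ (1+ε)D is claimed only when Λ_min ≤ (1+2ε)Λ_max; for larger Λ_min it can fail (e.g. ε=1, Λ_min=0.9, Λ_max=0.1). All other claims, including D ≤ Δ, need no such condition. *)

theory Defs
  imports
    "HOL-Analysis.Analysis"
    "HOL-Library.Real_Mod"
    "Graph_Theory.Shortest_Path"
    "Graph_Theory.Digraph_Component"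
begin

section \<open>Time-dependent network instances\<close>

text \<open>
  \<open>T\<close>-periodic, piecewise linear functions on \<open>[0,\<infinity>)\<close>. The set \<open>B\<close> contains representatives in
  \<open>[0,T)\<close> of all breakpoints, including the one at the period boundary, if there is one. Linearity
  is required on closed intervals, so that such a function has no jumps.
\<close>
definition periodic_pwl :: "real \<Rightarrow> (real \<Rightarrow> real) \<Rightarrow> real set \<Rightarrow> bool" where
  "periodic_pwl T g B \<longleftrightarrow>
     finite B \<and> B \<subseteq> {0..<T} \<and> (\<forall>t\<ge>0. g (t + T) = g t) \<and>
     (\<forall>a b. 0 \<le> a \<and> a < b \<and> (\<forall>t\<in>{a<..<b}. t rmod T \<notin> B) \<longrightarrow>
        (\<exists>m c. \<forall>t\<in>{a..b}. g t = m * t + c))"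

text \<open>
  Strong connectivity makes every \<open>D[o,d]\<close> a minimum over a nonempty set of paths.
\<close>
locale td_network = fin_digraph G for G :: "('v, 'a) pre_digraph" +
  fixes T :: real and D :: "'a \<Rightarrow> real \<Rightarrow> real"
  assumes strongly_connected: "strongly_connected G"
    and period_pos: "0 < T"
    and arc_time_continuous: "e \<in> arcs G \<Longrightarrow> continuous_on {0..} (D e)"
    and arc_time_periodic_pwl: "e \<in> arcs G \<Longrightarrow> \<exists>B. periodic_pwl T (D e) B"
    and arc_time_pos: "e \<in> arcs G \<Longrightarrow> 0 \<le> t \<Longrightarrow> 0 < D e t"

fun arrival :: "('a \<Rightarrow> real \<Rightarrow> real) \<Rightarrow> 'a list \<Rightarrow> real \<Rightarrow> real" where
  "arrival D [] t = t"
| "arrival D (e # p) t = arrival D p (t + D e t)"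

definition path_time :: "('a \<Rightarrow> real \<Rightarrow> real) \<Rightarrow> 'a list \<Rightarrow> real \<Rightarrow> real" where
  "path_time D p t = arrival D p t - t"

definition min_time ::
    "('v, 'a) pre_digraph \<Rightarrow> ('a \<Rightarrow> real \<Rightarrow> real) \<Rightarrow> 'v \<Rightarrow> 'v \<Rightarrow> real \<Rightarrow> real" where
  "min_time G D u v t = Min ((\<lambda>p. path_time D p t) ` {p. pre_digraph.apath G u p v})"

definition tdsp ::
    "('v, 'a) pre_digraph \<Rightarrow> ('a \<Rightarrow> real \<Rightarrow> real) \<Rightarrow> 'v \<Rightarrow> real \<Rightarrow> 'v \<Rightarrow> real" where
  "tdsp G D l t = (\<lambda>v. min_time G D l v t)"

definition bounded_slopes ::
    "('v, 'a) pre_digraph \<Rightarrow> ('a \<Rightarrow> real \<Rightarrow> real) \<Rightarrow> real \<Rightarrow> real \<Rightarrow> bool" where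
  "bounded_slopes G D \<Lambda>min \<Lambda>max \<longleftrightarrow>
     (\<forall>u\<in>verts G. \<forall>v\<in>verts G. \<forall>t1 t2. 0 \<le> t1 \<and> t1 < t2 \<longrightarrow>
        (min_time G D u v t1 - min_time G D u v t2) / (t1 - t2) \<in> {-\<Lambda>min..\<Lambda>max})"

definition ff_length :: "real \<Rightarrow> ('a \<Rightarrow> real \<Rightarrow> real) \<Rightarrow> 'a \<Rightarrow> real" where
  "ff_length T D e = (INF t\<in>{0..<T}. D e t)"

definition ff_dist ::
    "('v, 'a) pre_digraph \<Rightarrow> real \<Rightarrow> ('a \<Rightarrow> real \<Rightarrow> real) \<Rightarrow> 'v \<Rightarrow> 'v \<Rightarrow> real" where
  "ff_dist G T D u v = real_of_ereal (wf_digraph.\<mu> G (ff_length T D) u v)"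


section \<open>Dijkstra's algorithm and the Dijkstra rank\<close>

definition relax ::
    "('v, 'a) pre_digraph \<Rightarrow> ('a \<Rightarrow> real) \<Rightarrow> 'v \<Rightarrow> ('v \<Rightarrow> ereal) \<Rightarrow> 'v \<Rightarrow> ereal" where
  "relax G w u lab v =
     min (lab v) (INF e\<in>{e \<in> arcs G. tail G e = u \<and> head G e = v}. lab u + ereal (w e))"

text \<open>
  \<open>dijkstra G w s vs lab\<close>: from source \<open>s\<close>, the algorithm can reach a state in which exactly the
  vertices \<open>vs\<close> have been settled, in this order, and \<open>lab\<close> holds the tentative distances.
\<close>
inductive dijkstra ::
    "('v, 'a) pre_digraph \<Rightarrow> ('a \<Rightarrow> real) \<Rightarrow> 'v \<Rightarrow> 'v list \<Rightarrow> ('v \<Rightarrow> ereal) \<Rightarrow> bool"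
  for G w s where
  init: "dijkstra G w s [] (\<lambda>v. if v = s then 0 else \<infinity>)"
| settle: "dijkstra G w s vs lab \<Longrightarrow> u \<in> verts G - set vs \<Longrightarrow> lab u < \<infinity> \<Longrightarrow>
    (\<And>v. v \<in> verts G - set vs \<Longrightarrow> lab u \<le> lab v) \<Longrightarrow>
    dijkstra G w s (vs @ [u]) (relax G w u lab)"

text \<open>
  The number of vertices settled by the time \<open>d\<close> gets settled, \<open>d\<close> itself not counted, so that
  the rank of the source is \<open>0\<close>; counting \<open>d\<close> as well would make every bound
  \<open>rank(o,d) \<le> c \<cdot> dist(o,d)\<^sup>\<lambda>\<close> fail for \<open>d = o\<close>. Among the possible ways to break ties, the one
  that settles \<open>d\<close> earliest is taken. Both choices give the smallest possible value, hence the
  weakest hypothesis in an upper bound on the rank.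
\<close>
definition dijkstra_rank :: "('v, 'a) pre_digraph \<Rightarrow> ('a \<Rightarrow> real) \<Rightarrow> 'v \<Rightarrow> 'v \<Rightarrow> nat" where
  "dijkstra_rank G w s d = (LEAST k. \<exists>vs lab. dijkstra G w s (vs @ [d]) lab \<and> length vs = k)"

definition ff_rank ::
    "('v, 'a) pre_digraph \<Rightarrow> real \<Rightarrow> ('a \<Rightarrow> real \<Rightarrow> real) \<Rightarrow> 'v \<Rightarrow> 'v \<Rightarrow> nat" where
  "ff_rank G T D u v = dijkstra_rank G (ff_length T D) u v"


section \<open>The upper-approximating functions\<close>

definition sampling_width ::
    "('v, 'a) pre_digraph \<Rightarrow> real \<Rightarrow> ('a \<Rightarrow> real \<Rightarrow> real) \<Rightarrow> real \<Rightarrow> real \<Rightarrow> 'v \<Rightarrow> 'v \<Rightarrow> real" where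
  "sampling_width G T D \<epsilon> \<Lambda>max l v = ff_dist G T D l v / ((1 + 1 / \<epsilon>) * \<Lambda>max)"

definition far_verts ::
    "('v, 'a) pre_digraph \<Rightarrow> real \<Rightarrow> ('a \<Rightarrow> real \<Rightarrow> real) \<Rightarrow> real \<Rightarrow> real \<Rightarrow> 'v \<Rightarrow> real \<Rightarrow> 'v set" where
  "far_verts G T D \<epsilon> \<Lambda>max l \<tau> = {v \<in> verts G. sampling_width G T D \<epsilon> \<Lambda>max l v > \<tau>}"

definition num_intervals :: "real \<Rightarrow> real \<Rightarrow> nat" where
  "num_intervals T w = nat \<lceil>T / w\<rceil>"

definition interval_start :: "real \<Rightarrow> nat \<Rightarrow> real" where
  "interval_start w k = (real k - 1) * w"

definition interval_end :: "real \<Rightarrow> real \<Rightarrow> nat \<Rightarrow> real" where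
  "interval_end T w k = min (real k * w) T"

text \<open>
  The function \<open>\<delta>\<^sub>k\<close> on the interval \<open>[ts,tf)\<close>, where \<open>ds\<close> and \<open>df\<close> are the travel times sampled
  at \<open>ts\<close> and \<open>tf\<close>.
\<close>
definition upper_piece ::
    "real \<Rightarrow> real \<Rightarrow> real \<Rightarrow> real \<Rightarrow> real \<Rightarrow> real \<Rightarrow> real \<Rightarrow> real" where
  "upper_piece \<Lambda>min \<Lambda>max ts tf ds df t =
     min (df + \<Lambda>min * tf - \<Lambda>min * t) (ds - \<Lambda>max * ts + \<Lambda>max * t)"

definition periodic_concat :: "real \<Rightarrow> real \<Rightarrow> (nat \<Rightarrow> real \<Rightarrow> real) \<Rightarrow> real \<Rightarrow> real" where
  "periodic_concat T w \<delta> t =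
     (let t' = t rmod T;
          k = (THE k. k \<in> {1..num_intervals T w} \<and> t' \<in> {interval_start w k..<interval_end T w k})
      in \<delta> k t')"

definition upper_fun ::
    "real \<Rightarrow> real \<Rightarrow> real \<Rightarrow> real \<Rightarrow> (real \<Rightarrow> real) \<Rightarrow> real \<Rightarrow> real" where
  "upper_fun T w \<Lambda>min \<Lambda>max g = periodic_concat T w (\<lambda>k.
     upper_piece \<Lambda>min \<Lambda>max (interval_start w k) (interval_end T w k)
       (g (interval_start w k)) (g (interval_end T w k)))"

definition departure_times :: "real \<Rightarrow> real \<Rightarrow> real list" where
  "departure_times T w = map (\<lambda>j. real j * w) [0..<num_intervals T w]"

text \<open>
  The construction of the functions for all destinations at once. It sees the network only through
  \<open>sols\<close>, the list of the one-to-all solutions for the departure times above. The sample at the end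
  of interval \<open>k\<close> is the one at the start of interval \<open>k + 1\<close>; for the last interval it is, by
  periodicity, the one at time \<open>0\<close>, whence the index modulo the number of intervals.
\<close>
definition construct ::
    "real \<Rightarrow> real \<Rightarrow> real \<Rightarrow> real \<Rightarrow> ('v \<Rightarrow> real) list \<Rightarrow> 'v \<Rightarrow> real \<Rightarrow> real" where
  "construct T w \<Lambda>min \<Lambda>max sols v = periodic_concat T w (\<lambda>k.
     upper_piece \<Lambda>min \<Lambda>max (interval_start w k) (interval_end T w k)
       ((sols ! (k - 1)) v) ((sols ! (k mod num_intervals T w)) v))"

text \<open>
  On an interval of width \<open>w\<close> the pieces above exceed the travel time by at most
  \<open>(\<Lambda>min + \<Lambda>max) * w / 2\<close>, and this is attained. With widths up to the minimum of the sampling widths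
  this is at most \<open>\<epsilon>\<close> times the travel time if \<open>\<Lambda>min \<le> (1 + 2 * \<epsilon>) * \<Lambda>max\<close>. For larger \<open>\<Lambda>min\<close> there are
  networks in which the factor \<open>1 + \<epsilon>\<close> is exceeded, so the upper bound is claimed only under this
  condition.
\<close>
definition upper_approx :: "real \<Rightarrow> real set \<Rightarrow> (real \<Rightarrow> real) \<Rightarrow> (real \<Rightarrow> real) \<Rightarrow> bool" where
  "upper_approx c I g h \<longleftrightarrow> (\<forall>t\<in>I. h t \<le> g t \<and> g t \<le> c * h t)"

end

theory Submission
  imports Defs
begin

text \<open>
  On each sampling interval the slope bounds sandwich the travel time between its two end samples,
  so \<open>\<delta>\<^sub>k\<close> dominates it and exceeds it by at most \<open>\<Lambda>min + \<Lambda>max\<close> times the distance to the nearer end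
  of the interval; for \<open>\<Lambda>min \<le> (1 + 2 * \<epsilon>) * \<Lambda>max\<close>, the width \<open>\<tau>\<^sup>*\<close> makes this at most \<open>\<epsilon>\<close> times the free-flow
  distance, a lower bound of the travel time. For the number of samples, Dijkstra's algorithm settles
  every vertex outside \<open>V[\<ell>](\<tau>)\<close>, of which there are \<open>F > f(n)\<close>, before any vertex inside. The rank
  bound then forces the free-flow distances in \<open>V[\<ell>](\<tau>)\<close> above \<open>1\<close>, so that \<open>T / \<tau>\<^sup>*\<close> is
  at most a constant times \<open>T = n\<^sup>a\<close>.
\<close>

section \<open>Sampling a periodic function of bounded slope\<close>

text \<open>The ceiling hides a strict comparison with \<open>T / w\<close>; in this form later
  facts about the grid \<open>0, w, 2 * w, ...\<close> can avoid rounding up.\<close>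

lemma less_num_intervals_iff:
  assumes "0 < w"
  shows "k < num_intervals T w \<longleftrightarrow> real k * w < T"
proof -
  have "k < num_intervals T w \<longleftrightarrow> real k < T / w"
    unfolding num_intervals_def zless_nat_eq_int_zless less_ceiling_iff by simp
  also have "\<dots> \<longleftrightarrow> real k * w < T"
    using assms by (simp add: field_simps)
  finally show ?thesis .
qed

lemma num_intervals_pos: "0 < w \<Longrightarrow> 0 < T \<Longrightarrow> 0 < num_intervals T w"
  by (simp add: less_num_intervals_iff)

lemma interval_start_Suc [simp]: "interval_start w (Suc j) = real j * w"
  by (simp add: interval_start_def)

lemma interval_start_less:
  assumes "0 < w" "k \<in> {1..num_intervals T w}"
  shows "interval_start w k < T"
proof -
  obtain j where j: "k = Suc j" using assms(2) by (cases k) auto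
  with assms(2) have "j < num_intervals T w" by simp
  with assms(1) show ?thesis by (simp add: j less_num_intervals_iff)
qed

lemma interval_start_nonneg: "0 < w \<Longrightarrow> 1 \<le> k \<Longrightarrow> 0 \<le> interval_start w k"
  by (simp add: interval_start_def)

lemma interval_start_less_end:
  assumes "0 < w" "k \<in> {1..num_intervals T w}"
  shows "interval_start w k < interval_end T w k"
  using interval_start_less[OF assms] assms(1)
  by (simp add: interval_start_def interval_end_def)

lemma interval_width: "interval_end T w k - interval_start w k \<le> w"
  by (simp add: interval_start_def interval_end_def algebra_simps)

lemma interval_end_eq_start:
  assumes "0 < w" "k < num_intervals T w"
  shows "interval_end T w k = interval_start w (Suc k)"
  using assms by (simp add: less_num_intervals_iff interval_end_def)

lemma interval_end_last:
  assumes "0 < w" "\<not> k < num_intervals T w"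
  shows "interval_end T w k = T"
  using assms by (simp add: less_num_intervals_iff interval_end_def)

lemma interval_exists:
  assumes "0 < w" "0 \<le> t" "t < T"
  obtains k where "k \<in> {1..num_intervals T w}" "t \<in> {interval_start w k..<interval_end T w k}"
proof -
  \<comment> \<open>\<open>j\<close> counts grid cells from 0, the intervals are counted from 1, so
    the interval sought is number \<open>Suc j\<close>.\<close>
  define j where "j = nat \<lfloor>t / w\<rfloor>"
  have "0 \<le> t / w" using assms by simp
  hence "real j \<le> t / w" "t / w < real j + 1"
    unfolding j_def by simp_all
  hence *: "real j * w \<le> t" "t < real (Suc j) * w"
    using assms(1) by (simp_all add: field_simps)
  with assms have "j < num_intervals T w"
    by (simp add: less_num_intervals_iff)
  with * assms show ?thesis
    by (intro that[of "Suc j"]) (auto simp: interval_end_def)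
qed

lemma interval_unique:
  assumes "0 < w"
    and "t \<in> {interval_start w k..<interval_end T w k}"
    and "t \<in> {interval_start w k'..<interval_end T w k'}"
  shows "k = k'"
proof -
  have le: "i \<le> j" if "t \<in> {interval_start w i..<interval_end T w i}"
    "t \<in> {interval_start w j..<interval_end T w j}" for i j
  proof -
    \<comment> \<open>Start of \<open>i\<close> \<le> \<open>t\<close> < end of \<open>j\<close>
      \<le> \<open>j * w\<close>; exchanging the roles gives equality.\<close>
    have "(real i - 1) * w < real j * w"
      using that by (simp add: interval_start_def interval_end_def)
    hence "real i - 1 < real j" using assms(1) by simp
    thus "i \<le> j" by linarith
  qed
  show ?thesis using le[OF assms(2,3)] le[OF assms(3,2)] by simp
qed

section \<open>Periodic concatenation of pieces\<close>

lemma rmod_period_shift: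
  assumes "0 \<le> s" "s < T"
  shows "(real_of_int m * T + s) rmod T = s"
  using assms by (intro rmod_unique[where n = m]) auto

text \<open>Disjointness of the intervals resolves the definite description. Splitting off
  \<open>m\<close> whole periods gives the form in which later evaluations are made.\<close>

lemma periodic_concat_eq:
  assumes "0 < w" "0 < T" "k \<in> {1..num_intervals T w}"
    and "s \<in> {interval_start w k..<interval_end T w k}"
  shows "periodic_concat T w \<delta> (real_of_int m * T + s) = \<delta> k s"
proof -
  have s: "0 \<le> s" "s < T"
    using assms interval_start_nonneg[of w k] by (auto simp: interval_end_def)
  have "(THE k. k \<in> {1..num_intervals T w} \<and> s \<in> {interval_start w k..<interval_end T w k}) = k"
    using assms interval_unique by (intro the_equality) blast+
  thus ?thesis
    by (simp add: periodic_concat_def rmod_period_shift[OF s])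
qed

text \<open>Only pieces with index in \<open>{1..num_intervals T w}\<close> are ever selected. This
  allows comparing \<open>construct\<close> with \<open>upper_fun\<close>, whose pieces need not
  agree at other indices.\<close>

lemma periodic_concat_cong:
  assumes "0 < w" "0 < T" "\<And>k. k \<in> {1..num_intervals T w} \<Longrightarrow> \<delta> k = \<delta>' k"
  shows "periodic_concat T w \<delta> = periodic_concat T w \<delta>'"
proof
  fix t
  have "0 \<le> t rmod T" "t rmod T < T"
    using \<open>0 < T\<close> by (simp_all add: rmod_nonneg rmod_less)
  then obtain k where k: "k \<in> {1..num_intervals T w}"
      "t rmod T \<in> {interval_start w k..<interval_end T w k}"
    using interval_exists[OF \<open>0 < w\<close>] by blast
  have t: "t = real_of_int \<lfloor>t / T\<rfloor> * T + t rmod T"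
    using \<open>0 < T\<close> by (simp add: rmod_def)
  show "periodic_concat T w \<delta> t = periodic_concat T w \<delta>' t"
    by (subst (1 2) t) (simp add: periodic_concat_eq[OF assms(1,2) k] assms(3)[OF k(1)])
qed

section \<open>Departure times of the sampling\<close>

lemma length_departure_times [simp]: "length (departure_times T w) = num_intervals T w"
  by (simp add: departure_times_def)

lemma nth_departure_times:
  "j < num_intervals T w \<Longrightarrow> departure_times T w ! j = real j * w"
  by (simp add: departure_times_def)

lemma distinct_departure_times: "0 < w \<Longrightarrow> distinct (departure_times T w)"
  by (auto simp: departure_times_def distinct_map inj_on_def)

lemma set_departure_times: "set (departure_times T w) = (\<lambda>j. real j * w) ` {..<num_intervals T w}"
  by (auto simp: departure_times_def)

text \<open>Every end but the last is the next start, and the last end \<open>T\<close> is time 0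
  modulo the period. Sampling both ends of all intervals thus takes no more departure times than
  there are intervals.\<close>

lemma set_departure_times_conv_endpoints:
  assumes "0 < w" "0 < T"
  shows "set (departure_times T w) =
    (\<Union>k\<in>{1..num_intervals T w}. {interval_start w k rmod T, interval_end T w k rmod T})"
    (is "?L = ?R")
proof
  have start: "interval_start w (Suc j) rmod T = real j * w" if "j < num_intervals T w" for j
    using that assms by (simp add: less_num_intervals_iff)
  show "?L \<subseteq> ?R"
  proof
    fix x assume "x \<in> ?L"
    then obtain j where j: "j < num_intervals T w" "x = real j * w"
      by (auto simp: set_departure_times)
    with start[OF j(1)] show "x \<in> ?R"
      by (intro UN_I[of "Suc j"]) auto
  qed
  show "?R \<subseteq> ?L"
  proof
    fix x assume "x \<in> ?R"
    then obtain k where k: "k \<in> {1..num_intervals T w}"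
      and x: "x = interval_start w k rmod T \<or> x = interval_end T w k rmod T" by auto
    obtain j where j: "k = Suc j" using k by (cases k) auto
    from x show "x \<in> ?L"
    proof
      assume "x = interval_start w k rmod T"
      thus ?thesis using k start[of j] by (auto simp: j set_departure_times)
    next
      assume x: "x = interval_end T w k rmod T"
      show ?thesis
      proof (cases "k < num_intervals T w")
        case True
        thus ?thesis using x start[of k] interval_end_eq_start[OF assms(1) True]
          by (auto simp: set_departure_times)
      next
        case False
        with x have "x = real 0 * w" using interval_end_last[OF assms(1) False] by simp
        thus ?thesis using num_intervals_pos[OF assms] unfolding set_departure_times by blast
      qed
    qed
  qed
qed

text \<open>Isolates what the sampling argument uses about \<open>min_time G D l v\<close>. The
  slope bounds are multiplied out, so that \<open>s = t\<close> is allowed.\<close>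

locale sampled_function =
  fixes T w \<Lambda>min \<Lambda>max :: real and g :: "real \<Rightarrow> real"
  assumes T_pos: "0 < T" and w_pos: "0 < w"
    and \<Lambda>min_nonneg: "0 \<le> \<Lambda>min" and \<Lambda>max_pos: "0 < \<Lambda>max"
    and periodic: "\<And>t. 0 \<le> t \<Longrightarrow> g (t + T) = g t"
    and decrease: "\<And>s t. 0 \<le> s \<Longrightarrow> s \<le> t \<Longrightarrow> g s - \<Lambda>min * (t - s) \<le> g t"
    and increase: "\<And>s t. 0 \<le> s \<Longrightarrow> s \<le> t \<Longrightarrow> g t \<le> g s + \<Lambda>max * (t - s)"
begin

abbreviation "K \<equiv> num_intervals T w"
abbreviation "ts \<equiv> interval_start w"
abbreviation "tf \<equiv> interval_end T w"
abbreviation "\<delta> k \<equiv> upper_piece \<Lambda>min \<Lambda>max (ts k) (tf k) (g (ts k)) (g (tf k))"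
abbreviation "\<Delta> \<equiv> upper_fun T w \<Lambda>min \<Lambda>max g"

text \<open>Each of the two lines lies above \<open>g\<close> by one slope bound; by the other it
  overshoots \<open>g\<close> by at most \<open>\<Lambda>min + \<Lambda>max\<close> times the
  distance to the end from which it is drawn.\<close>

lemma piece_bounds:
  assumes "k \<in> {1..K}" "t \<in> {ts k..tf k}"
  shows "g t \<le> \<delta> k t" and "\<delta> k t \<le> g t + (\<Lambda>min + \<Lambda>max) * w / 2"
proof -
  have t: "0 \<le> ts k" "ts k \<le> t" "t \<le> tf k"
    using assms interval_start_nonneg[OF w_pos] by auto
  have dec: "g (ts k) - \<Lambda>min * (t - ts k) \<le> g t" "g t - \<Lambda>min * (tf k - t) \<le> g (tf k)"
    using t by (auto intro!: decrease)
  have inc: "g t \<le> g (ts k) + \<Lambda>max * (t - ts k)" "g (tf k) \<le> g t + \<Lambda>max * (tf k - t)"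
    using t by (auto intro!: increase)
  show "g t \<le> \<delta> k t"
    using dec inc by (simp add: upper_piece_def algebra_simps)
  have "\<delta> k t \<le> g t + (\<Lambda>min + \<Lambda>max) * (tf k - t)"
    unfolding upper_piece_def using inc by (intro min.coboundedI1) (simp add: algebra_simps)
  moreover have "\<delta> k t \<le> g t + (\<Lambda>min + \<Lambda>max) * (t - ts k)"
    unfolding upper_piece_def using dec by (intro min.coboundedI2) (simp add: algebra_simps)
  \<comment> \<open>When both estimates are added, the two distances sum to the interval length,
    whence the factor 1/2.\<close>
  ultimately have "2 * \<delta> k t \<le> 2 * g t + (\<Lambda>min + \<Lambda>max) * (tf k - ts k)"
    by (simp add: algebra_simps)
  also have "\<dots> \<le> 2 * g t + (\<Lambda>min + \<Lambda>max) * w"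
    using interval_width[of T w k] \<Lambda>min_nonneg \<Lambda>max_pos by (intro add_left_mono mult_left_mono) auto
  finally show "\<delta> k t \<le> g t + (\<Lambda>min + \<Lambda>max) * w / 2" by simp
qed

text \<open>The line drawn from an end passes through the sample there, and a slope bound keeps the
  other line above it. With the same fact at the right end, neighbouring pieces meet.\<close>

lemma piece_start:
  assumes "k \<in> {1..K}"
  shows "\<delta> k (ts k) = g (ts k)"
  using decrease[of "ts k" "tf k"] interval_start_nonneg[OF w_pos, of k]
    interval_start_less_end[OF w_pos assms] assms
  by (simp add: upper_piece_def algebra_simps)

lemma piece_end:
  assumes "k \<in> {1..K}"
  shows "\<delta> k (tf k) = g (tf k)"
  using increase[of "ts k" "tf k"] interval_start_nonneg[OF w_pos, of k]
    interval_start_less_end[OF w_pos assms] assms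
  by (simp add: upper_piece_def algebra_simps)

text \<open>The right endpoint is included because adjacent pieces agree there.\<close>
lemma upper_fun_eq_piece:
  assumes k: "k \<in> {1..K}" and s: "s \<in> {ts k..tf k}"
  shows "\<Delta> (real_of_int m * T + s) = \<delta> k s"
proof (cases "s = tf k")
  case False
  with s have "s \<in> {ts k..<tf k}" by auto
  thus ?thesis
    unfolding upper_fun_def by (rule periodic_concat_eq[OF w_pos T_pos k])
next
  case s_end: True
  show ?thesis
  proof (cases "k < K")
    case True
    have end_eq: "tf k = ts (Suc k)" by (rule interval_end_eq_start[OF w_pos True])
    have k': "Suc k \<in> {1..K}" using True by simp
    have "\<Delta> (real_of_int m * T + ts (Suc k)) = \<delta> (Suc k) (ts (Suc k))"
      unfolding upper_fun_def using interval_start_less_end[OF w_pos k']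
      by (intro periodic_concat_eq[OF w_pos T_pos k']) auto
    also have "\<dots> = g (ts (Suc k))" by (rule piece_start[OF k'])
    also have "\<dots> = \<delta> k (tf k)" using piece_end[OF k] end_eq by simp
    finally show ?thesis using s_end end_eq by simp
  next
    case False
    have end_eq: "tf k = T" by (rule interval_end_last[OF w_pos False])
    have k1: "1 \<in> {1..K}" using num_intervals_pos[OF w_pos T_pos] by simp
    have ts1: "ts 1 = 0" by (simp add: interval_start_def)
    \<comment> \<open>Offset \<open>T\<close> in period \<open>m\<close> is offset 0 in period
      \<open>m + 1\<close>, so the first piece is evaluated there.\<close>
    have "\<Delta> (real_of_int (m + 1) * T + ts 1) = \<delta> 1 (ts 1)"
      unfolding upper_fun_def using interval_start_less_end[OF w_pos k1]
      by (intro periodic_concat_eq[OF w_pos T_pos k1]) auto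
    also have "\<dots> = g 0" using piece_start[OF k1] ts1 by simp
    also have "\<dots> = g T" using periodic[of 0] by simp
    also have "\<dots> = \<delta> k (tf k)" using piece_end[OF k] end_eq by simp
    finally show ?thesis using s_end end_eq ts1 by (simp add: algebra_simps)
  qed
qed

lemma upper_fun_bounds:
  assumes "t \<in> {0..<T}"
  shows "g t \<le> \<Delta> t" and "\<Delta> t \<le> g t + (\<Lambda>min + \<Lambda>max) * w / 2"
proof -
  obtain k where k: "k \<in> {1..K}" "t \<in> {ts k..<tf k}"
    using interval_exists[OF w_pos] assms by (metis atLeastLessThan_iff)
  hence t: "t \<in> {ts k..tf k}" by auto
  have "\<Delta> t = \<delta> k t" using upper_fun_eq_piece[OF k(1) t, of 0] by simp
  with piece_bounds[OF k(1) t] show "g t \<le> \<Delta> t" "\<Delta> t \<le> g t + (\<Lambda>min + \<Lambda>max) * w / 2"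
    by simp_all
qed

section \<open>Breakpoints and piecewise linearity\<close>

definition crossing :: "nat \<Rightarrow> real" where
  "crossing k = (g (tf k) + \<Lambda>min * tf k - (g (ts k) - \<Lambda>max * ts k)) / (\<Lambda>min + \<Lambda>max)"

lemma piece_crossing:
  shows "t \<le> crossing k \<Longrightarrow> \<delta> k t = \<Lambda>max * t + (g (ts k) - \<Lambda>max * ts k)"
    and "crossing k \<le> t \<Longrightarrow> \<delta> k t = - \<Lambda>min * t + (g (tf k) + \<Lambda>min * tf k)"
  using \<Lambda>min_nonneg \<Lambda>max_pos by (auto simp: upper_piece_def crossing_def min_def field_simps)

text \<open>Each interval contributes its start and the point where its two lines meet. Ends are not
  listed because each is a start modulo \<open>T\<close>; a meeting point equal to \<open>T\<close>
  is cut off, but its representative 0 is the first start.\<close>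

definition breaks :: "real set" where
  "breaks = (ts ` {1..K} \<union> crossing ` {1..K}) \<inter> {0..<T}"

lemma card_breaks: "card breaks \<le> 2 * K"
proof -
  have "card breaks \<le> card (ts ` {1..K} \<union> crossing ` {1..K})"
    unfolding breaks_def by (intro card_mono) auto
  also have "\<dots> \<le> card (ts ` {1..K}) + card (crossing ` {1..K})" by (rule card_Un_le)
  also have "\<dots> \<le> K + K"
    using card_image_le[of "{1..K}" ts] card_image_le[of "{1..K}" crossing] by simp
  finally show ?thesis by simp
qed

text \<open>Shifted by whole periods, an interval without breaks inside cannot leave the sampling
  interval in which it begins, since the end of that one is a break modulo \<open>T\<close>; nor can
  it straddle \<open>crossing k\<close>. A single line remains.\<close>

lemma upper_fun_affine:
  assumes "0 \<le> a" "a < b" and no_break: "\<forall>t\<in>{a<..<b}. t rmod T \<notin> breaks"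
  shows "\<exists>m c. \<forall>t\<in>{a..b}. \<Delta> t = m * t + c"
proof -
  define n where "n = \<lfloor>a / T\<rfloor>"
  define a' where "a' = a rmod T"
  define b' where "b' = a' + (b - a)"
  have a: "a = real_of_int n * T + a'"
    using T_pos by (simp add: rmod_def a'_def n_def)
  have b: "b = real_of_int n * T + b'" using a by (simp add: b'_def)
  have a': "0 \<le> a'" "a' < T" "a' < b'"
    using T_pos assms by (simp_all add: a'_def b'_def rmod_nonneg rmod_less)
  \<comment> \<open>Below \<open>T\<close> an offset is its own remainder; the period boundary is
    treated separately.\<close>
  have no_break': "s \<notin> breaks" if "a' < s" "s < b'" "s < T" for s
    using no_break[rule_format, of "real_of_int n * T + s"] that a'
    by (simp add: a b rmod_period_shift)
  obtain k where k: "k \<in> {1..K}" "a' \<in> {ts k..<tf k}"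
    using interval_exists[OF w_pos a'(1,2)] by blast
  have "b' \<le> tf k"
  proof (rule ccontr)
    assume less: "\<not> b' \<le> tf k"
    show False
    proof (cases "k < K")
      case True
      have "ts (Suc k) \<in> breaks"
        using True interval_start_less[OF w_pos, of "Suc k" T] interval_start_nonneg[OF w_pos, of "Suc k"]
        by (simp add: breaks_def del: interval_start_Suc)
      moreover have "tf k < T"
        using interval_end_eq_start[OF w_pos True] interval_start_less[OF w_pos, of "Suc k" T] True
        by (simp del: interval_start_Suc)
      ultimately show False
        using no_break'[of "tf k"] less k(2) interval_end_eq_start[OF w_pos True] by simp
    next
      case False
      \<comment> \<open>Here \<open>T\<close> lies strictly between \<open>a'\<close> and
        \<open>b'\<close>; its remainder 0 is the start of the first interval, a break.\<close>
      have "T = tf k" using interval_end_last[OF w_pos False] by simp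
      hence "T rmod T \<notin> breaks"
        using no_break[rule_format, of "real_of_int n * T + T"] less k(2) a' a b
          rmod_period_shift[of 0 T "n + 1"] T_pos
        by (simp add: algebra_simps)
      moreover have "ts 1 \<in> breaks"
        using num_intervals_pos[OF w_pos T_pos] T_pos by (auto simp: breaks_def interval_start_def)
      ultimately show False by (simp add: interval_start_def)
    qed
  qed
  hence piece: "\<Delta> t = \<delta> k (t - real_of_int n * T)" if "t \<in> {a..b}" for t
    using upper_fun_eq_piece[OF k(1), of "t - real_of_int n * T" n] that k(2)
    by (auto simp: a b)
  \<comment> \<open>This places any crossing between \<open>a'\<close> and \<open>b'\<close> in
    \<open>{0..<T}\<close>, so that \<open>breaks\<close> would contain it.\<close>
  have "b' \<le> T" using \<open>b' \<le> tf k\<close> by (simp add: interval_end_def)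
  hence "\<not> (a' < crossing k \<and> crossing k < b')"
    using no_break'[of "crossing k"] k(1) a'(1) by (auto simp: breaks_def)
  then consider "b' \<le> crossing k" | "crossing k \<le> a'" by linarith
  thus ?thesis
  proof cases
    case 1
    have "\<Delta> t = \<Lambda>max * t + (g (ts k) - \<Lambda>max * ts k - \<Lambda>max * (real_of_int n * T))"
      if "t \<in> {a..b}" for t
      using piece[OF that] piece_crossing(1)[of "t - real_of_int n * T" k] 1 that b
      by (simp add: algebra_simps)
    thus ?thesis by blast
  next
    case 2
    have "\<Delta> t = - \<Lambda>min * t + (g (tf k) + \<Lambda>min * tf k + \<Lambda>min * (real_of_int n * T))"
      if "t \<in> {a..b}" for t
      using piece[OF that] piece_crossing(2)[of k "t - real_of_int n * T"] 2 that a
      by (simp add: algebra_simps)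
    thus ?thesis by blast
  qed
qed

lemma periodic_pwl_upper_fun: "periodic_pwl T \<Delta> breaks"
proof -
  have "(t + T) rmod T = t rmod T" for t
    using rmod_add[of t T T] by simp
  hence "\<Delta> (t + T) = \<Delta> t" for t
    by (simp add: upper_fun_def periodic_concat_def)
  moreover have "finite breaks" "breaks \<subseteq> {0..<T}" by (auto simp: breaks_def)
  ultimately show ?thesis
    using upper_fun_affine by (auto simp: periodic_pwl_def)
qed

lemma construct_eq_upper_fun:
  assumes sols: "\<And>j. j < K \<Longrightarrow> (sols ! j) v = g (real j * w)"
  shows "construct T w \<Lambda>min \<Lambda>max sols v = \<Delta>"
  unfolding construct_def upper_fun_def
proof (rule periodic_concat_cong[OF w_pos T_pos])
  fix k assume k: "k \<in> {1..K}"
  obtain j where j: "k = Suc j" using k by (cases k) auto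
  have "(sols ! (k - 1)) v = g (ts k)" using sols[of j] k by (simp add: j)
  moreover have "(sols ! (k mod K)) v = g (tf k)"
  proof (cases "k < K")
    case True
    thus ?thesis using sols[of k] interval_end_eq_start[OF w_pos True] by simp
  next
    case False
    hence "k = K" using k by simp
    hence "(sols ! (k mod K)) v = g 0" using sols[of 0] num_intervals_pos[OF w_pos T_pos] by simp
    also have "\<dots> = g (tf k)"
      using periodic[of 0] interval_end_last[OF w_pos False] by simp
    finally show ?thesis .
  qed
  ultimately show "upper_piece \<Lambda>min \<Lambda>max (ts k) (tf k) ((sols ! (k - 1)) v) ((sols ! (k mod K)) v) = \<delta> k"
    by simp
qed

end

section \<open>Dijkstra's algorithm\<close>

context fin_digraph
begin

section \<open>Labels and settled vertices\<close>

lemma relax_le_lab: "relax G w u lab v \<le> lab v"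
  by (simp add: relax_def)

lemma relax_le_arc:
  assumes "e \<in> arcs G" "tail G e = u" "head G e = v"
  shows "relax G w u lab v \<le> lab u + ereal (w e)"
  unfolding relax_def using assms by (intro min.coboundedI2 INF_lower) auto

lemma relax_greatest:
  assumes "c \<le> lab v"
    and "\<And>e. e \<in> arcs G \<Longrightarrow> tail G e = u \<Longrightarrow> head G e = v \<Longrightarrow> c \<le> lab u + ereal (w e)"
  shows "c \<le> relax G w u lab v"
  unfolding relax_def using assms by (intro min.boundedI INF_greatest) auto

text \<open>By induction along the run: relaxing an arc respects the triangle inequality of
  \<open>\<mu>\<close>.\<close>

lemma dijkstra_lab_ge_mu:
  assumes "dijkstra G w s vs lab" and nonneg: "\<And>e. e \<in> arcs G \<Longrightarrow> 0 \<le> w e"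
    and "s \<in> verts G"
  shows "\<mu> w s v \<le> lab v"
  using assms(1)
proof (induction arbitrary: v)
  case init
  have "\<mu> w s s \<le> 0"
    using min_cost_le_walk_cost[of s "[]" s w] \<open>s \<in> verts G\<close> by (simp add: awalk_Nil_iff zero_ereal_def)
  thus ?case by auto
next
  case (settle vs lab u)
  show ?case
  proof (rule relax_greatest[OF settle.IH])
    fix e assume e: "e \<in> arcs G" "tail G e = u" "head G e = v"
    have "\<mu> w s v \<le> \<mu> w s u + ereal (w e)"
      using nonneg e by (intro pos_cost_mu_triangle) (auto simp: arc_to_ends_def)
    also have "\<dots> \<le> lab u + ereal (w e)" by (intro add_right_mono settle.IH)
    finally show "\<mu> w s v \<le> lab u + ereal (w e)" .
  qed
qed

text \<open>Correctness of settled labels is not claimed. Relaxed arcs out of settled vertices carry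
  label bounds along walks; the order between settled and unsettled labels preserves this, as later
  steps then leave settled labels alone.\<close>

definition dijkstra_inv :: "('b \<Rightarrow> real) \<Rightarrow> 'a \<Rightarrow> 'a list \<Rightarrow> ('a \<Rightarrow> ereal) \<Rightarrow> bool" where
  "dijkstra_inv w s vs lab \<longleftrightarrow> set vs \<subseteq> verts G \<and> distinct vs \<and> lab s \<le> 0 \<and>
     (\<forall>x\<in>set vs. \<forall>y\<in>verts G - set vs. lab x \<le> lab y) \<and>
     (\<forall>e\<in>arcs G. tail G e \<in> set vs \<longrightarrow> lab (head G e) \<le> lab (tail G e) + ereal (w e))"

lemma dijkstra_invariant:
  assumes "dijkstra G w s vs lab" and nonneg: "\<And>e. e \<in> arcs G \<Longrightarrow> 0 \<le> w e"
  shows "dijkstra_inv w s vs lab"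
  using assms(1)
proof induction
  case init
  show ?case by (simp add: dijkstra_inv_def)
next
  case (settle vs lab u)
  let ?lab' = "relax G w u lab"
  have inv: "set vs \<subseteq> verts G" "distinct vs" "lab s \<le> 0"
    "\<And>x y. x \<in> set vs \<Longrightarrow> y \<in> verts G - set vs \<Longrightarrow> lab x \<le> lab y"
    "\<And>e. e \<in> arcs G \<Longrightarrow> tail G e \<in> set vs \<Longrightarrow> lab (head G e) \<le> lab (tail G e) + ereal (w e)"
    using settle.IH by (auto simp: dijkstra_inv_def)
  have u: "u \<in> verts G" "u \<notin> set vs" using settle.hyps by auto
  \<comment> \<open>With nonnegative weights, relaxing lowers no label below
    \<open>lab u\<close>.\<close>
  have ge: "min (lab v) (lab u) \<le> ?lab' v" for v
  proof (rule relax_greatest)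
    fix e assume "e \<in> arcs G"
    hence "lab u + 0 \<le> lab u + ereal (w e)" using nonneg by (intro add_left_mono) simp
    thus "min (lab v) (lab u) \<le> lab u + ereal (w e)" by (simp add: min.coboundedI2)
  qed simp
  \<comment> \<open>Labels up to \<open>lab u\<close> are therefore unchanged, in particular those
    of the settled vertices and of \<open>u\<close>.\<close>
  have old: "?lab' x = lab x" if "x \<in> set (vs @ [u])" for x
  proof (rule antisym[OF relax_le_lab])
    have "lab x \<le> lab u" using that inv(4)[of x u] u by auto
    thus "lab x \<le> ?lab' x" using ge[of x] by (simp add: min_absorb1)
  qed
  show ?case unfolding dijkstra_inv_def
  proof (intro conjI ballI impI)
    show "set (vs @ [u]) \<subseteq> verts G" "distinct (vs @ [u])" using inv u by auto
    show "?lab' s \<le> 0" using relax_le_lab inv(3) by (rule order_trans)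
  next
    fix x y assume x: "x \<in> set (vs @ [u])" and y: "y \<in> verts G - set (vs @ [u])"
    have "lab x \<le> lab u" using x inv(4)[of x u] u by auto
    moreover have "lab u \<le> lab y" using y settle.hyps(4) by auto
    ultimately have "lab x \<le> min (lab y) (lab u)" by simp
    also have "\<dots> \<le> ?lab' y" by (rule ge)
    finally show "?lab' x \<le> ?lab' y" using old[OF x] by simp
  next
    fix e assume e: "e \<in> arcs G" "tail G e \<in> set (vs @ [u])"
    show "?lab' (head G e) \<le> ?lab' (tail G e) + ereal (w e)"
    proof (cases "tail G e = u")
      case True
      thus ?thesis using relax_le_arc[OF e(1) True refl] old[OF e(2)] by simp
    next
      case False
      hence "lab (head G e) \<le> lab (tail G e) + ereal (w e)" using e inv(5) by simp
      thus ?thesis using relax_le_lab old[OF e(2)] by (metis order_trans)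
    qed
  qed
qed

text \<open>The walk ends outside the settled set; its first unsettled vertex has a label of at most
  \<open>c\<close> plus the cost up to there, since the arcs before it are relaxed. In the
  induction, \<open>c\<close> absorbs the cost already walked.\<close>

lemma dijkstra_frontier:
  assumes inv: "dijkstra_inv w s vs lab" and nonneg: "\<And>e. e \<in> arcs G \<Longrightarrow> 0 \<le> w e"
    and "awalk x p v" "v \<notin> set vs" "lab x \<le> c"
  shows "\<exists>y\<in>verts G - set vs. lab y \<le> c + ereal (awalk_cost w p)"
  using assms(3,5)
proof (induction p arbitrary: x c)
  case Nil
  thus ?case using \<open>v \<notin> set vs\<close> by (auto simp: awalk_Nil_iff)
next
  case (Cons e p)
  hence e: "e \<in> arcs G" "x = tail G e" "awalk (head G e) p v" by (auto simp: awalk_Cons_iff)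
  show ?case
  proof (cases "x \<in> set vs")
    case True
    hence "lab (head G e) \<le> lab x + ereal (w e)" using inv e by (auto simp: dijkstra_inv_def)
    also have "\<dots> \<le> c + ereal (w e)" by (intro add_right_mono Cons.prems)
    finally show ?thesis using Cons.IH[OF e(3), of "c + ereal (w e)"] by (simp add: add.assoc)
  next
    case False
    have "0 \<le> awalk_cost w (e # p)" using Cons.prems(1) nonneg by (rule pos_cost_pos_awalk_cost)
    hence "c + 0 \<le> c + ereal (awalk_cost w (e # p))" by (intro add_left_mono) simp
    thus ?thesis using False e Cons.prems(2) by (intro bexI[of _ x]) auto
  qed
qed

text \<open>Otherwise a walk to \<open>v\<close> cheaper than \<open>\<mu> w s d\<close> meets an
  unsettled vertex with a label below that of \<open>d\<close>, contradicting the choice of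
  \<open>d\<close>.\<close>

lemma dijkstra_settles_closer:
  assumes "dijkstra G w s (vs @ [d]) lab" and nonneg: "\<And>e. e \<in> arcs G \<Longrightarrow> 0 \<le> w e"
    and "s \<in> verts G" "\<mu> w s v < \<mu> w s d"
  shows "v \<in> set vs"
proof (rule ccontr)
  assume v: "v \<notin> set vs"
  \<comment> \<open>Inversion recovers the state just before \<open>d\<close> is settled.\<close>
  from assms(1) obtain lab' where run: "dijkstra G w s vs lab'"
    and least: "\<And>y. y \<in> verts G - set vs \<Longrightarrow> lab' d \<le> lab' y"
    by cases auto
  have inv: "dijkstra_inv w s vs lab'" by (rule dijkstra_invariant[OF run nonneg])
  obtain p where p: "awalk s p v" "ereal (awalk_cost w p) < \<mu> w s d"
    using assms(4) unfolding \<mu>_def[of w s v] by (auto simp: INF_less_iff)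
  obtain y where y: "y \<in> verts G - set vs" "lab' y \<le> 0 + ereal (awalk_cost w p)"
    using dijkstra_frontier[OF inv nonneg p(1) v, of 0] inv by (auto simp: dijkstra_inv_def)
  have "\<mu> w s d \<le> lab' d" by (rule dijkstra_lab_ge_mu[OF run nonneg assms(3)])
  also have "\<dots> \<le> lab' y" by (rule least[OF y(1)])
  also have "\<dots> \<le> ereal (awalk_cost w p)" using y(2) by simp
  finally show False using p(2) by simp
qed

text \<open>While \<open>d\<close> is unsettled, a walk to \<open>d\<close> meets an unsettled
  vertex with label below \<open>\<infinity>\<close>, so one more vertex can be settled. This makes
  the \<open>LEAST\<close> in \<open>dijkstra_rank\<close> an attained value.\<close>

lemma dijkstra_eventually_settles:
  assumes "dijkstra G w s vs lab" and nonneg: "\<And>e. e \<in> arcs G \<Longrightarrow> 0 \<le> w e"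
    and "s \<rightarrow>\<^sup>* d" "d \<notin> set vs"
  shows "\<exists>us lab'. dijkstra G w s (us @ [d]) lab'"
  using assms(1,4)
proof (induction "card (verts G - set vs)" arbitrary: vs lab rule: less_induct)
  case less
  have inv: "dijkstra_inv w s vs lab" by (rule dijkstra_invariant[OF less.prems(1) nonneg])
  obtain p where "awalk s p d" using assms(3) by (auto simp: reachable_awalk)
  then obtain y where y: "y \<in> verts G - set vs" "lab y \<le> 0 + ereal (awalk_cost w p)"
    using dijkstra_frontier[OF inv nonneg _ less.prems(2), of s p 0] inv
    by (auto simp: dijkstra_inv_def)
  define u where "u = arg_min_on lab (verts G - set vs)"
  have fin: "finite (verts G - set vs)" by simp
  have u: "u \<in> verts G - set vs" "\<And>v. v \<in> verts G - set vs \<Longrightarrow> lab u \<le> lab v"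
    unfolding u_def using y(1) arg_min_if_finite(1)[OF fin, of lab] arg_min_least[OF fin, of _ lab]
    by blast+
  have "lab u < \<infinity>" using u(2)[OF y(1)] y(2) by auto
  hence step: "dijkstra G w s (vs @ [u]) (relax G w u lab)"
    using dijkstra.settle[OF less.prems(1) u(1)] u(2) by blast
  show ?case
  proof (cases "u = d")
    case True
    thus ?thesis using step by blast
  next
    case False
    have "card (verts G - set (vs @ [u])) < card (verts G - set vs)"
      using u(1) by (intro psubset_card_mono) auto
    thus ?thesis using less.hyps[OF _ step] less.prems(2) False by simp
  qed
qed

text \<open>Some run attains the rank; because the distances in \<open>S\<close> are strictly
  smaller, \<open>S\<close> precedes \<open>d\<close> in it however ties are broken.\<close>

lemma card_le_dijkstra_rank:
  assumes nonneg: "\<And>e. e \<in> arcs G \<Longrightarrow> 0 \<le> w e" and "s \<rightarrow>\<^sup>* d"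
    and closer: "\<And>v. v \<in> S \<Longrightarrow> \<mu> w s v < \<mu> w s d"
  shows "card S \<le> dijkstra_rank G w s d"
proof -
  have s: "s \<in> verts G" using assms(2) by (rule reachable_in_vertsE)
  obtain vs lab where "dijkstra G w s (vs @ [d]) lab"
    using dijkstra_eventually_settles[OF dijkstra.init[of G w s] nonneg assms(2)] by auto
  hence "\<exists>k vs lab. dijkstra G w s (vs @ [d]) lab \<and> length vs = k" by blast
  hence "\<exists>vs lab. dijkstra G w s (vs @ [d]) lab \<and> length vs = dijkstra_rank G w s d"
    unfolding dijkstra_rank_def by (rule LeastI_ex)
  then obtain us lab' where us: "dijkstra G w s (us @ [d]) lab'" "length us = dijkstra_rank G w s d"
    by blast
  have "S \<subseteq> set us"
    using dijkstra_settles_closer[OF us(1) nonneg s closer] by blast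
  hence "card S \<le> card (set us)" by (intro card_mono) auto
  also have "\<dots> \<le> length us" by (rule card_length)
  finally show ?thesis using us(2) by simp
qed

end

section \<open>Travel times\<close>

context td_network
begin

section \<open>Periodicity and free-flow lower bounds\<close>

lemma arc_time_periodic:
  assumes "e \<in> arcs G" "0 \<le> t"
  shows "D e (t + T) = D e t"
  using arc_time_periodic_pwl[OF assms(1)] assms(2) by (auto simp: periodic_pwl_def)

lemma bdd_below_arc_time: "e \<in> arcs G \<Longrightarrow> bdd_below (D e ` {0..<T})"
  by (rule bdd_belowI[of _ 0]) (auto intro: less_imp_le[OF arc_time_pos])

lemma ff_length_nonneg: "e \<in> arcs G \<Longrightarrow> 0 \<le> ff_length T D e"
  unfolding ff_length_def using period_pos by (intro cINF_greatest) (auto intro: less_imp_le[OF arc_time_pos])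

text \<open>\<open>ff_length\<close> is an infimum over one period; periodicity transfers the bound
  to all departure times, such as those at which a path enters its later arcs.\<close>

lemma ff_length_le_arc_time:
  assumes e: "e \<in> arcs G" and "0 \<le> t"
  shows "ff_length T D e \<le> D e t"
proof -
  have shift: "D e (real n * T + s) = D e s" if "0 \<le> s" for n s
  proof (induction n)
    case (Suc n)
    have "D e (real n * T + s + T) = D e (real n * T + s)"
      using that period_pos by (intro arc_time_periodic[OF e]) simp
    thus ?case using Suc by (simp add: algebra_simps)
  qed simp
  have r: "0 \<le> t rmod T" "t rmod T < T" using period_pos by (simp_all add: rmod_nonneg rmod_less)
  have "t = real (nat \<lfloor>t / T\<rfloor>) * T + t rmod T"
    using period_pos \<open>0 \<le> t\<close> by (simp add: rmod_def)
  hence "D e t = D e (t rmod T)" using shift[OF r(1)] by metis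
  moreover have "ff_length T D e \<le> D e (t rmod T)"
    unfolding ff_length_def using r by (intro cINF_lower bdd_below_arc_time[OF e]) auto
  ultimately show ?thesis by simp
qed

lemma arrival_shift:
  assumes "set p \<subseteq> arcs G" "0 \<le> t"
  shows "arrival D p (t + T) = arrival D p t + T"
  using assms
proof (induction p arbitrary: t)
  case (Cons e p)
  have "0 < D e t" using Cons.prems by (intro arc_time_pos) auto
  hence "arrival D p (t + D e t + T) = arrival D p (t + D e t) + T"
    using Cons by simp
  thus ?case using Cons.prems arc_time_periodic[of e t] by (simp add: algebra_simps)
qed simp

lemma awalk_cost_le_path_time:
  assumes "set p \<subseteq> arcs G" "0 \<le> t"
  shows "awalk_cost (ff_length T D) p \<le> path_time D p t"
  using assms unfolding path_time_def
proof (induction p arbitrary: t)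
  case (Cons e p)
  have "0 < D e t" using Cons.prems by (intro arc_time_pos) auto
  hence "awalk_cost (ff_length T D) p \<le> arrival D p (t + D e t) - (t + D e t)"
    using Cons by simp
  thus ?case using Cons.prems ff_length_le_arc_time[of e t] by simp
qed simp

lemma min_time_periodic:
  assumes "0 \<le> t"
  shows "min_time G D u v (t + T) = min_time G D u v t"
proof -
  have "path_time D p (t + T) = path_time D p t" if "apath u p v" for p
    using that arrival_shift[of p t] assms by (auto simp: path_time_def apath_def awalk_def)
  thus ?thesis unfolding min_time_def by (intro arg_cong[where f = Min] image_cong) auto
qed

lemma reachable_verts: "u \<in> verts G \<Longrightarrow> v \<in> verts G \<Longrightarrow> u \<rightarrow>\<^sup>*\<^bsub>G\<^esub> v"
  using strongly_connected by (auto simp: strongly_connected_def)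

text \<open>\<open>real_of_ereal\<close> would turn an infinite distance into 0. Strong connectivity
  bounds the distance by the cost of a walk, and nonnegative lengths bound it below.\<close>

lemma mu_eq_ff_dist:
  assumes "u \<in> verts G" "v \<in> verts G"
  shows "\<mu> (ff_length T D) u v = ereal (ff_dist G T D u v)" and "0 \<le> ff_dist G T D u v"
proof -
  obtain p where p: "awalk u p v" using reachable_verts[OF assms] by (auto simp: reachable_awalk)
  have "\<mu> (ff_length T D) u v \<le> ereal (awalk_cost (ff_length T D) p)"
    by (rule min_cost_le_walk_cost[OF p])
  moreover have nonneg: "0 \<le> \<mu> (ff_length T D) u v"
    unfolding \<mu>_def by (intro INF_greatest) (auto intro: pos_cost_pos_awalk_cost ff_length_nonneg)
  ultimately have "\<bar>\<mu> (ff_length T D) u v\<bar> \<noteq> \<infinity>" by auto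
  thus "\<mu> (ff_length T D) u v = ereal (ff_dist G T D u v)"
    by (simp add: ff_dist_def ereal_real)
  show "0 \<le> ff_dist G T D u v" using nonneg by (simp add: ff_dist_def real_of_ereal_pos)
qed

lemma ff_dist_le_min_time:
  assumes "u \<in> verts G" "v \<in> verts G" "0 \<le> t"
  shows "ff_dist G T D u v \<le> min_time G D u v t"
proof -
  have "\<exists>p. apath u p v" using reachable_verts[OF assms(1,2)] by (simp add: reachable_apath)
  moreover have "ff_dist G T D u v \<le> path_time D p t" if p: "apath u p v" for p
  proof -
    have aw: "awalk u p v" "set p \<subseteq> arcs G" using p by (auto simp: apath_def awalk_def)
    have "ereal (ff_dist G T D u v) \<le> ereal (awalk_cost (ff_length T D) p)"
      using min_cost_le_walk_cost[OF aw(1), of "ff_length T D"] mu_eq_ff_dist[OF assms(1,2)] by simp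
    also have "\<dots> \<le> ereal (path_time D p t)"
      using awalk_cost_le_path_time[OF aw(2) assms(3)] by simp
    finally show ?thesis by simp
  qed
  ultimately show ?thesis
    unfolding min_time_def using apaths_finite[of u v] by (subst Min_ge_iff) auto
qed

lemma sampled_min_time:
  assumes "bounded_slopes G D \<Lambda>min \<Lambda>max" "0 \<le> \<Lambda>min" "0 < \<Lambda>max" "0 < w"
    and "u \<in> verts G" "v \<in> verts G"
  shows "sampled_function T w \<Lambda>min \<Lambda>max (min_time G D u v)"
proof
  let ?g = "min_time G D u v"
  have slope: "- \<Lambda>min * (t - s) \<le> ?g t - ?g s \<and> ?g t - ?g s \<le> \<Lambda>max * (t - s)"
    if "0 \<le> s" "s < t" for s t
  proof -
    \<comment> \<open>\<open>bounded_slopes\<close> divides by the negative \<open>t1 - t2\<close>;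
      both signs are flipped first.\<close>
    have "(?g s - ?g t) / (s - t) = (?g t - ?g s) / (t - s)"
      by (metis minus_diff_eq minus_divide_divide)
    moreover have "(?g s - ?g t) / (s - t) \<in> {-\<Lambda>min..\<Lambda>max}"
      using assms that unfolding bounded_slopes_def by blast
    ultimately show ?thesis
      using that by (simp add: pos_le_divide_eq pos_divide_le_eq)
  qed
  fix s t :: real assume "0 \<le> s" "s \<le> t"
  thus "?g s - \<Lambda>min * (t - s) \<le> ?g t" "?g t \<le> ?g s + \<Lambda>max * (t - s)"
    using slope[of s t] by (cases "s = t"; simp)+
qed (use assms period_pos min_time_periodic in auto)

text \<open>
  All vertices outside \<open>S\<close> are settled before \<open>v\<close>, so the rank bound reads
  \<open>F \<le> c \<cdot> dist\<^sup>\<lambda>\<close> with \<open>c < F\<close>.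
\<close>
lemma ff_dist_gt_1:
  assumes rank: "real (ff_rank G T D l v) \<le> c * ff_dist G T D l v powr lam"
    and "1 \<le> c" "c < real F" "1 \<le> lam" "l \<in> verts G" "v \<in> verts G"
    and "S \<subseteq> verts G" "S \<noteq> {}" "card S = card (verts G) - F"
    and closer: "\<And>x. x \<in> verts G - S \<Longrightarrow> ff_dist G T D l x < ff_dist G T D l v"
  shows "1 < ff_dist G T D l v"
proof (rule ccontr)
  let ?d = "ff_dist G T D l v"
  assume "\<not> 1 < ?d"
  hence "?d powr lam \<le> 1 powr lam"
    using assms mu_eq_ff_dist(2)[of l v] by (intro powr_mono2) auto
  hence "c * ?d powr lam \<le> c * 1" using assms by (intro mult_left_mono) auto
  moreover have "F \<le> ff_rank G T D l v"
  proof -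
    have fin: "finite S" using assms(7) by (rule finite_subset) simp
    \<comment> \<open>Nonemptiness of \<open>S\<close> rules out truncation in
      \<open>card (verts G) - F\<close>, so exactly \<open>F\<close> vertices lie outside
      \<open>S\<close>.\<close>
    hence "0 < card S" using \<open>S \<noteq> {}\<close> by (simp add: card_gt_0_iff)
    hence "F < card (verts G)" using assms(9) by simp
    hence "F = card (verts G - S)" using assms fin by (simp add: card_Diff_subset)
    also have "\<dots> \<le> ff_rank G T D l v"
      unfolding ff_rank_def
    proof (rule card_le_dijkstra_rank)
      fix x assume x: "x \<in> verts G - S"
      thus "\<mu> (ff_length T D) l x < \<mu> (ff_length T D) l v"
        using closer[OF x] mu_eq_ff_dist(1)[of l] assms by simp
    qed (use assms reachable_verts ff_length_nonneg in auto)
    finally show ?thesis .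
  qed
  ultimately show False using rank assms by linarith
qed

end

text \<open>\<open>C\<close> precedes the network in the quantifier order, so it depends on
  \<open>\<epsilon>\<close> and \<open>\<Lambda>max\<close> alone. The number of one-to-all problems
  appears as the length of the list of departure times whose solutions \<open>construct\<close>
  receives.\<close>

theorem theorem1:
  fixes \<epsilon> \<Lambda>max :: real
  assumes "0 < \<epsilon>" and "0 < \<Lambda>max"
  shows "\<exists>C. \<forall>(G :: ('v, 'a) pre_digraph) T D a \<Lambda>min lam (f :: nat \<Rightarrow> real) L l F \<tau>.
     td_network G T D \<and>
     0 < a \<and> a < 1 \<and> T = real (card (verts G)) powr a \<and>
     0 \<le> \<Lambda>min \<and> \<Lambda>min < 1 \<and> bounded_slopes G D \<Lambda>min \<Lambda>max \<and>
     1 \<le> lam \<and> (\<forall>m. 1 \<le> f m) \<and>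
     (\<forall>u\<in>verts G. \<forall>v\<in>verts G.
        real (ff_rank G T D u v) \<le> f (card (verts G)) * ff_dist G T D u v powr lam) \<and>
     L \<subseteq> verts G \<and> l \<in> L \<and>
     f (card (verts G)) < real F \<and>
     0 < \<tau> \<and> \<tau> < T \<and>
     far_verts G T D \<epsilon> \<Lambda>max l \<tau> \<noteq> {} \<and>
     card (far_verts G T D \<epsilon> \<Lambda>max l \<tau>) = card (verts G) - F
     \<longrightarrow>
     (let W = far_verts G T D \<epsilon> \<Lambda>max l \<tau>;
          w = Min (sampling_width G T D \<epsilon> \<Lambda>max l ` W);
          K = num_intervals T w;
          \<Delta> = (\<lambda>v. upper_fun T w \<Lambda>min \<Lambda>max (min_time G D l v))
      in
        (\<forall>v\<in>W. \<forall>t\<in>{0..<T}. min_time G D l v t \<le> \<Delta> v t) \<and>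
        (\<Lambda>min \<le> (1 + 2 * \<epsilon>) * \<Lambda>max \<longrightarrow>
           (\<forall>v\<in>W. upper_approx (1 + \<epsilon>) {0..<T} (\<Delta> v) (min_time G D l v))) \<and>
        (\<forall>v\<in>W. \<exists>B. periodic_pwl T (\<Delta> v) B \<and> card B \<le> 2 * K) \<and>
        length (departure_times T w) = K \<and>
        distinct (departure_times T w) \<and>
        set (departure_times T w) =
          (\<Union>k\<in>{1..K}. {interval_start w k rmod T, interval_end T w k rmod T}) \<and>
        (\<forall>v\<in>W. construct T w \<Lambda>min \<Lambda>max (map (tdsp G D l) (departure_times T w)) v = \<Delta> v) \<and>
        real_of_int \<lceil>T / w\<rceil> \<le> 1 + T * (1 + 1 / \<epsilon>) * \<Lambda>max / Min (ff_dist G T D l ` W) \<and>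
        1 + T * (1 + 1 / \<epsilon>) * \<Lambda>max / Min (ff_dist G T D l ` W)
          \<le> C * real (card (verts G)) powr a)"
proof -
  \<comment> \<open>The common denominator of all sampling widths.\<close>
  define c where "c = (1 + 1 / \<epsilon>) * \<Lambda>max"
  have c: "0 < c" using assms by (simp add: c_def add_pos_pos)
  show ?thesis
  \<comment> \<open>\<open>1 + c\<close> works because \<open>T\<close> is at least 1 and the least
    distance \<open>dmin\<close> exceeds 1, so that
    \<open>1 + T * c / dmin \<le> (1 + c) * T\<close>.\<close>
  proof (intro exI[of _ "1 + c"] allI impI, elim conjE)
    fix G :: "('v, 'a) pre_digraph" and T :: real and D a \<Lambda>min lam and f :: "nat \<Rightarrow> real"
      and L l F \<tau>
    assume "td_network G T D" and a: "0 < a" "a < 1" "T = real (card (verts G)) powr a"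
      and \<Lambda>min: "0 \<le> \<Lambda>min" "\<Lambda>min < 1" and slopes: "bounded_slopes G D \<Lambda>min \<Lambda>max"
      and lam: "1 \<le> lam" and f: "\<forall>m. 1 \<le> f m"
      and rank: "\<forall>u\<in>verts G. \<forall>v\<in>verts G.
        real (ff_rank G T D u v) \<le> f (card (verts G)) * ff_dist G T D u v powr lam"
      and l: "L \<subseteq> verts G" "l \<in> L" and F: "f (card (verts G)) < real F"
      and \<tau>: "0 < \<tau>" "\<tau> < T"
      and W_ne: "far_verts G T D \<epsilon> \<Lambda>max l \<tau> \<noteq> {}"
      and W_card: "card (far_verts G T D \<epsilon> \<Lambda>max l \<tau>) = card (verts G) - F"
    interpret td_network G T D by fact
    define W where "W = far_verts G T D \<epsilon> \<Lambda>max l \<tau>"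
    define d where "d = ff_dist G T D l"
    define dmin where "dmin = Min (d ` W)"
    define w where "w = Min (sampling_width G T D \<epsilon> \<Lambda>max l ` W)"
    define g where "g = min_time G D l"
    have width: "sampling_width G T D \<epsilon> \<Lambda>max l v = d v / c" for v
      by (simp add: sampling_width_def c_def d_def)
    have W: "W \<subseteq> verts G" "W \<noteq> {}" "card W = card (verts G) - F"
      using W_ne W_card by (auto simp: W_def far_verts_def)
    have W_iff: "v \<in> W \<longleftrightarrow> v \<in> verts G \<and> \<tau> * c < d v" for v
      using c by (simp add: W_def far_verts_def width field_simps)
    have finW: "finite W" using W(1) by (rule finite_subset) simp
    have lG: "l \<in> verts G" using l by blast
    \<comment> \<open>A monotone map commutes with \<open>Min\<close>, so the least width is the
      least distance divided by \<open>c\<close>.\<close>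
    have "mono (\<lambda>x. x / c)" using c by (intro monoI divide_right_mono) auto
    hence w_eq: "w = dmin / c"
      using mono_Min_commute[of "\<lambda>x. x / c" "d ` W"] finW W(2)
      by (simp add: w_def dmin_def width image_image)
    have d_gt_1: "1 < d v" if v: "v \<in> W" for v
      unfolding d_def
    proof (rule ff_dist_gt_1[of _ _ "f (card (verts G))" lam F W])
      \<comment> \<open>Outside \<open>W\<close> distances are at most \<open>\<tau> * c\<close>,
        inside they exceed it.\<close>
      fix x assume "x \<in> verts G - W"
      thus "ff_dist G T D l x < ff_dist G T D l v" using v W_iff[of x] W_iff[of v] unfolding d_def by auto
    qed (use v W rank f F lam lG in auto)
    have dmin: "1 < dmin" unfolding dmin_def using finW W(2) d_gt_1 by simp
    have w_pos: "0 < w" using dmin c by (simp add: w_eq)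
    have sampled: "sampled_function T w \<Lambda>min \<Lambda>max (g v)" if "v \<in> W" for v
      unfolding g_def using that W(1) by (intro sampled_min_time slopes \<Lambda>min assms w_pos lG) auto
    have err: "(\<Lambda>min + \<Lambda>max) * w / 2 \<le> \<epsilon> * g v t"
      if \<Lambda>: "\<Lambda>min \<le> (1 + 2 * \<epsilon>) * \<Lambda>max" and v: "v \<in> W" and t: "t \<in> {0..<T}" for v t
    proof -
      \<comment> \<open>The condition on \<open>\<Lambda>min\<close> says exactly that
        \<open>\<Lambda>min + \<Lambda>max\<close> is at most
        \<open>2 * (1 + \<epsilon>) * \<Lambda>max\<close>, which equals
        \<open>2 * \<epsilon> * c\<close>.\<close>
      have "(\<Lambda>min + \<Lambda>max) * w / 2 \<le> ((1 + 2 * \<epsilon>) * \<Lambda>max + \<Lambda>max) * w / 2"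
        using \<Lambda> w_pos by (intro divide_right_mono mult_right_mono) auto
      also have "\<dots> = \<epsilon> * (c * w)"
        using assms by (simp add: c_def field_simps)
      also have "c * w = dmin" using c by (simp add: w_eq)
      also have "dmin \<le> d v" unfolding dmin_def using finW v by simp
      also have "d v \<le> g v t"
        unfolding d_def g_def using v W(1) t lG by (intro ff_dist_le_min_time) auto
      finally show ?thesis using assms by simp
    qed
    have bounds: "g v t \<le> upper_fun T w \<Lambda>min \<Lambda>max (g v) t"
      "upper_fun T w \<Lambda>min \<Lambda>max (g v) t \<le> g v t + (\<Lambda>min + \<Lambda>max) * w / 2"
      if "v \<in> W" "t \<in> {0..<T}" for v t
      using sampled_function.upper_fun_bounds[OF sampled[OF that(1)] that(2)] .
    have construct: "construct T w \<Lambda>min \<Lambda>max (map (tdsp G D l) (departure_times T w)) v =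
      upper_fun T w \<Lambda>min \<Lambda>max (g v)" if "v \<in> W" for v
      by (rule sampled_function.construct_eq_upper_fun[OF sampled[OF that]])
        (simp add: nth_departure_times tdsp_def g_def)
    have T_div_w: "T / w = T * (1 + 1 / \<epsilon>) * \<Lambda>max / dmin"
      using c by (simp add: w_eq c_def)
    have "verts G \<noteq> {}" using lG by auto
    hence "1 \<le> T"
      using a by (simp add: ge_one_powr_ge_zero card_gt_0_iff Suc_le_eq)
    moreover have "T * c / dmin \<le> T * c"
      using dmin c \<open>1 \<le> T\<close> by (simp add: pos_divide_le_eq)
    ultimately have bigO: "1 + T * (1 + 1 / \<epsilon>) * \<Lambda>max / dmin \<le> (1 + c) * real (card (verts G)) powr a"
      using a(3) by (simp add: c_def algebra_simps)
    note folds = W_def[symmetric] w_def[symmetric] d_def[symmetric] dmin_def[symmetric]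
      fun_cong[OF g_def, symmetric]
    have "\<forall>v\<in>W. \<forall>t\<in>{0..<T}. g v t \<le> upper_fun T w \<Lambda>min \<Lambda>max (g v) t"
      using bounds(1) by blast
    moreover have "\<Lambda>min \<le> (1 + 2 * \<epsilon>) * \<Lambda>max \<longrightarrow>
        (\<forall>v\<in>W. upper_approx (1 + \<epsilon>) {0..<T} (upper_fun T w \<Lambda>min \<Lambda>max (g v)) (g v))"
      using bounds order_trans[OF bounds(2) add_left_mono[OF err]]
      by (simp add: upper_approx_def distrib_right)
    moreover have "\<forall>v\<in>W. \<exists>B. periodic_pwl T (upper_fun T w \<Lambda>min \<Lambda>max (g v)) B \<and>
        card B \<le> 2 * num_intervals T w"
      using sampled sampled_function.periodic_pwl_upper_fun sampled_function.card_breaks by blast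
    moreover have "real_of_int \<lceil>T / w\<rceil> \<le> 1 + T * (1 + 1 / \<epsilon>) * \<Lambda>max / dmin"
      unfolding T_div_w[symmetric] by linarith
    ultimately show "(let W = far_verts G T D \<epsilon> \<Lambda>max l \<tau>;
          w = Min (sampling_width G T D \<epsilon> \<Lambda>max l ` W);
          K = num_intervals T w;
          \<Delta> = (\<lambda>v. upper_fun T w \<Lambda>min \<Lambda>max (min_time G D l v))
      in
        (\<forall>v\<in>W. \<forall>t\<in>{0..<T}. min_time G D l v t \<le> \<Delta> v t) \<and>
        (\<Lambda>min \<le> (1 + 2 * \<epsilon>) * \<Lambda>max \<longrightarrow>
           (\<forall>v\<in>W. upper_approx (1 + \<epsilon>) {0..<T} (\<Delta> v) (min_time G D l v))) \<and>
        (\<forall>v\<in>W. \<exists>B. periodic_pwl T (\<Delta> v) B \<and> card B \<le> 2 * K) \<and>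
        length (departure_times T w) = K \<and>
        distinct (departure_times T w) \<and>
        set (departure_times T w) =
          (\<Union>k\<in>{1..K}. {interval_start w k rmod T, interval_end T w k rmod T}) \<and>
        (\<forall>v\<in>W. construct T w \<Lambda>min \<Lambda>max (map (tdsp G D l) (departure_times T w)) v = \<Delta> v) \<and>
        real_of_int \<lceil>T / w\<rceil> \<le> 1 + T * (1 + 1 / \<epsilon>) * \<Lambda>max / Min (ff_dist G T D l ` W) \<and>
        1 + T * (1 + 1 / \<epsilon>) * \<Lambda>max / Min (ff_dist G T D l ` W)
          \<le> (1 + c) * real (card (verts G)) powr a)"
      unfolding Let_def folds
      using set_departure_times_conv_endpoints[OF w_pos period_pos] construct bigO
      by (simp add: distinct_departure_times[OF w_pos])
  qed
qed

end
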